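(* Let $G=(V_G,E_G)$ be a hypergraph with $V_G=\{0,1,\dots,p\}\subset\mathbb{N}_0$ and $E_G$ a finite (multi)collection of nonempty subsets of $V_G$. Write each edge as the tuple of its nodes in strictly ascending order, order the edges in descending lexicographic order (a proper prefix of a tuple being lexicographically smaller than the tuple), and let $T$ be the concatenation of these tuples in that order, a string of length $M_G=\sum_{e\in E_G}|e|$; thus each edge occupies a block of consecutive positions $k,k+1,\dots,k+r-1$ of $T$. Let $SA$ be the suffix array of $T$ and $SA^{-1}$ its inverse. Define the permutation $\Psi$ of $\{0,\dots,M_G-1\}$ by: if $SA[i]$ is not the last position of its edge block, $\Psi[i]=SA^{-1}[SA[i]+1]$; if $SA[i]$ is the last position of the edge block starting at position $k$, $\Psi[i]=SA^{-1}[k]$. Then the sequence $\Psi[0],\Psi[1],\dots,\Psi[M_G-1]$ is a concatenation of at most $|V_G|$ contiguous strictly increasing subsequences.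
   Context: For a string $T$ of length $n$, $T[i..]$ is the suffix starting at position $i$; the suffix array $SA$ is the permutation of $\{0,\dots,n-1\}$ such that $T[SA[0]..]<T[SA[1]..]<\cdots<T[SA[n-1]..]$ in lexicographic order (a proper prefix being smaller). The collection $E_G$ may contain repeated edges; each edge contains each node once. With this definition, repeated application of $\Psi$ starting from a suffix-array position cycles through the suffix-array positions of the nodes of exactly one edge. *)

theory Defs
  imports "HOL-Library.Multiset" "HOL-Library.List_Lexorder" "HOL-Combinatorics.Permutations"
begin

definition hypergraph :: "nat set \<Rightarrow> nat set multiset \<Rightarrow> bool" where
  "hypergraph V E \<longleftrightarrow> (\<exists>p. V = {0..p}) \<and> (\<forall>e\<in>#E. e \<noteq> {} \<and> e \<subseteq> V)"

text \<open>
  The order on lists is the one of \<^theory>\<open>HOL-Library.List_Lexorder\<close>: lexicographic, with a proper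
  prefix being smaller. It is used for the edge tuples and for the suffixes.
\<close>

definition edge_tuples :: "nat set multiset \<Rightarrow> nat list list" where
  "edge_tuples E = rev (sorted_list_of_multiset (image_mset sorted_list_of_set E))"

definition edge_text :: "nat set multiset \<Rightarrow> nat list" where
  "edge_text E = concat (edge_tuples E)"

definition total_size :: "nat set multiset \<Rightarrow> nat" where
  "total_size E = (\<Sum>e\<in>#E. card e)"

definition is_suffix_array :: "'a::linorder list \<Rightarrow> (nat \<Rightarrow> nat) \<Rightarrow> bool" where
  "is_suffix_array T sa \<longleftrightarrow> sa permutes {..<length T} \<and>
     (\<forall>i j. i < j \<longrightarrow> j < length T \<longrightarrow> drop (sa i) T < drop (sa j) T)"

definition suffix_array :: "'a::linorder list \<Rightarrow> nat \<Rightarrow> nat" where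
  "suffix_array T = (THE sa. is_suffix_array T sa)"

text \<open>
  The block of the \<open>m\<close>-th tuple of \<open>ts\<close> in \<open>concat ts\<close> consists of the positions \<open>q\<close> with
  \<open>block_start ts m \<le> q < block_start ts (Suc m)\<close>.
\<close>

definition block_start :: "'a list list \<Rightarrow> nat \<Rightarrow> nat" where
  "block_start ts m = length (concat (take m ts))"

definition block_of :: "'a list list \<Rightarrow> nat \<Rightarrow> nat" where
  "block_of ts q =
     (THE m. m < length ts \<and> block_start ts m \<le> q \<and> q < block_start ts (Suc m))"

definition Psi :: "nat set multiset \<Rightarrow> nat \<Rightarrow> nat" where
  "Psi E i =
     (let ts = edge_tuples E; SA = suffix_array (edge_text E); q = SA i; m = block_of ts q
      in if q + 1 < block_start ts (Suc m) then inv SA (q + 1) else inv SA (block_start ts m))"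

lemma length_edge_text:
  assumes "hypergraph V E"
  shows "length (edge_text E) = total_size E"
proof -
  have "length (edge_text E) = sum_mset (image_mset length (mset (edge_tuples E)))"
    by (simp add: edge_text_def length_concat flip: sum_mset_sum_list)
  also have "\<dots> = (\<Sum>e\<in>#E. length (sorted_list_of_set e))"
    by (simp add: edge_tuples_def image_mset.compositionality comp_def)
  finally show ?thesis by (simp add: total_size_def)
qed

lemma suffix_array_exists: "\<exists>sa. is_suffix_array T sa"
proof -
  let ?n = "length T"
  define xs where "xs = sort_key (\<lambda>i. drop i T) [0..<?n]"
  define sa where "sa i = (if i < ?n then xs ! i else i)" for i
  have len: "length xs = ?n" and set: "set xs = {..<?n}" and dist: "distinct xs"
    by (auto simp: xs_def)
  have "bij_betw (\<lambda>i. xs ! i) {..<?n} {..<?n}"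
    using bij_betw_nth[OF dist] len set by simp
  then have "bij_betw sa {..<?n} {..<?n}"
    by (rule bij_betw_cong[THEN iffD1, rotated]) (simp add: sa_def)
  then have perm: "sa permutes {..<?n}"
    by (rule bij_imp_permutes) (simp add: sa_def)
  have "drop (sa i) T < drop (sa j) T" if "i < j" "j < ?n" for i j
  proof -
    have le: "drop (xs ! i) T \<le> drop (xs ! j) T"
      using sorted_nth_mono[of "map (\<lambda>i. drop i T) xs" i j] that len
      by (simp add: xs_def)
    have "xs ! i \<noteq> xs ! j" using dist that len by (simp add: nth_eq_iff_index_eq)
    moreover have "xs ! i < ?n" "xs ! j < ?n"
      using nth_mem[of i xs] nth_mem[of j xs] that len set by auto
    ultimately have "length (drop (xs ! i) T) \<noteq> length (drop (xs ! j) T)" by auto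
    with le have "drop (xs ! i) T < drop (xs ! j) T" by (metis order_le_less)
    then show ?thesis using that by (simp add: sa_def)
  qed
  with perm show ?thesis unfolding is_suffix_array_def by blast
qed

lemma suffix_array_unique:
  assumes f: "is_suffix_array T f" and g: "is_suffix_array T g"
  shows "f = g"
proof -
  let ?n = "length T"
  let ?l = "\<lambda>h. map (\<lambda>i. drop (h i) T) [0..<?n]"
  have srt: "sorted (?l h) \<and> distinct (?l h) \<and> set (?l h) = (\<lambda>i. drop i T) ` {..<?n}"
    if h: "is_suffix_array T h" for h
  proof (intro conjI)
    have p: "h permutes {..<?n}" and l: "\<And>i j. i < j \<Longrightarrow> j < ?n \<Longrightarrow> drop (h i) T < drop (h j) T"
      using h by (auto simp: is_suffix_array_def)
    have s: "sorted_wrt (<) (?l h)" by (simp add: sorted_wrt_iff_nth_less l)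
    then show "sorted (?l h)" "distinct (?l h)" by (auto simp: strict_sorted_iff)
    have "set (?l h) = (\<lambda>i. drop i T) ` h ` {..<?n}" by (auto simp: image_image)
    then show "set (?l h) = (\<lambda>i. drop i T) ` {..<?n}" by (simp add: permutes_image[OF p])
  qed
  have eq: "?l f = ?l g"
    using srt[OF f] srt[OF g] sorted_distinct_set_unique[of "?l f" "?l g"] by auto
  have pf: "f permutes {..<?n}" and pg: "g permutes {..<?n}"
    using f g by (auto simp: is_suffix_array_def)
  show ?thesis
  proof
    fix i
    show "f i = g i"
    proof (cases "i < ?n")
      case True
      then have "drop (f i) T = drop (g i) T" using arg_cong[OF eq, of "\<lambda>l. l ! i"] by simp
      then have "?n - f i = ?n - g i" by (metis length_drop)
      moreover have "f i < ?n" "g i < ?n"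
        using True permutes_in_image[OF pf] permutes_in_image[OF pg] by auto
      ultimately show ?thesis by simp
    next
      case False
      then show ?thesis using pf pg by (simp add: permutes_def)
    qed
  qed
qed

lemma is_suffix_array_suffix_array: "is_suffix_array T (suffix_array T)"
  unfolding suffix_array_def
  using theI'[of "is_suffix_array T"] suffix_array_exists suffix_array_unique by metis

lemma block_start_mono: "m \<le> m' \<Longrightarrow> block_start ts m \<le> block_start ts m'"
proof -
  assume "m \<le> m'"
  then obtain d where "m' = m + d" using le_Suc_ex by blast
  then show ?thesis by (simp add: block_start_def take_add)
qed

lemma block_of_eq:
  assumes "m < length ts" "block_start ts m \<le> q" "q < block_start ts (Suc m)"
  shows "block_of ts q = m"
  unfolding block_of_def
proof (rule the_equality)
  show "m < length ts \<and> block_start ts m \<le> q \<and> q < block_start ts (Suc m)"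
    using assms by simp
next
  fix m' assume m': "m' < length ts \<and> block_start ts m' \<le> q \<and> q < block_start ts (Suc m')"
  have "\<not> m' < m" using block_start_mono[of "Suc m'" m ts] m' assms by auto
  moreover have "\<not> m < m'" using block_start_mono[of "Suc m" m' ts] m' assms by auto
  ultimately show "m' = m" by simp
qed

lemma block_exists:
  assumes "q < length (concat ts)"
  shows "\<exists>m<length ts. block_start ts m \<le> q \<and> q < block_start ts (Suc m)"
proof -
  have "q < block_start ts (length ts)" using assms by (simp add: block_start_def)
  moreover define k where "k = (LEAST k. q < block_start ts k)"
  ultimately have k: "q < block_start ts k" "k \<le> length ts"
    by (auto intro: LeastI Least_le)
  have "k \<noteq> 0" using k(1) by (cases k) (auto simp: block_start_def)
  then obtain m where m: "k = Suc m" using not0_implies_Suc by blast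
  have "\<not> q < block_start ts m" using not_less_Least[of m "\<lambda>k. q < block_start ts k"] m k_def by auto
  then show ?thesis using k m by (intro exI[of _ m]) auto
qed

lemma Psi_permutation:
  "bij_betw (Psi E) {..<length (edge_text E)} {..<length (edge_text E)}"
proof -
  let ?n = "length (edge_text E)"
  let ?ts = "edge_tuples E"
  let ?b = "block_start ?ts"
  let ?SA = "suffix_array (edge_text E)"
  define nx where "nx q = (if q + 1 < ?b (Suc (block_of ?ts q)) then q + 1 else ?b (block_of ?ts q))"
    for q
  have p: "?SA permutes {..<?n}"
    using is_suffix_array_suffix_array[of "edge_text E"] by (simp add: is_suffix_array_def)
  have Psi: "Psi E = inv ?SA \<circ> (nx \<circ> ?SA)"
    by (rule ext) (simp add: Psi_def nx_def Let_def)
  have blk: "block_of ?ts q < length ?ts \<and> ?b (block_of ?ts q) \<le> q \<and> q < ?b (Suc (block_of ?ts q))"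
    if q: "q < ?n" for q
  proof -
    obtain m where "m < length ?ts" "?b m \<le> q" "q < ?b (Suc m)"
      using block_exists[of q ?ts] q by (auto simp: edge_text_def)
    then show ?thesis using block_of_eq[of m ?ts q] by simp
  qed
  have nx: "nx q < ?n \<and> block_of ?ts (nx q) = block_of ?ts q" if q: "q < ?n" for q
  proof -
    let ?m = "block_of ?ts q"
    note B = blk[OF q]
    have r: "?b ?m \<le> nx q" "nx q < ?b (Suc ?m)" using B by (auto simp: nx_def)
    have "?b (Suc ?m) \<le> ?b (length ?ts)" using B by (intro block_start_mono) auto
    then have "?b (Suc ?m) \<le> ?n" by (simp add: block_start_def edge_text_def)
    then show ?thesis using r B block_of_eq[of ?m ?ts "nx q"] by auto
  qed
  have "inj_on nx {..<?n}"
  proof (rule inj_onI)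
    fix x y assume x: "x \<in> {..<?n}" and y: "y \<in> {..<?n}" and e: "nx x = nx y"
    have m: "block_of ?ts x = block_of ?ts y" using nx[of x] nx[of y] x y e by auto
    then show "x = y" using e blk[of x] blk[of y] x y by (auto simp: nx_def split: if_splits)
  qed
  moreover have "nx ` {..<?n} \<subseteq> {..<?n}" using nx by auto
  ultimately have "bij_betw nx {..<?n} {..<?n}"
    by (simp add: bij_betw_def endo_inj_surj)
  then show ?thesis unfolding Psi
    using permutes_imp_bij[OF p] permutes_imp_bij[OF permutes_inv[OF p]]
    by (intro bij_betw_trans[of _ _ "{..<?n}"]) 
qed

end

theory Submission
  imports Defs
begin

text \<open>
  Write \<open>T\<close> for the text. The letters \<open>T[SA[i]]\<close> are weakly increasing in \<open>i\<close> and take at most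
  \<open>|V|\<close> values, so it suffices that \<open>\<Psi>\<close> is strictly increasing on positions with equal letter.
  Let \<open>q\<close> and \<open>q'\<close> carry the same letter \<open>c\<close> with \<open>T[q..] < T[q'..]\<close>, hence
  \<open>T[q+1..] < T[q'+1..]\<close>. If \<open>q\<close> does not end its edge, then \<open>\<Psi>\<close> leads to \<open>q+1\<close>, where the letter
  exceeds \<open>c\<close>. If \<open>q\<close> ends its edge, then \<open>\<Psi>\<close> leads to the start of the edge; neither there nor
  at \<open>q+1\<close>, the start of the next edge, does the letter exceed \<open>c\<close>. This settles all cases except
  the one where \<open>q\<close> and \<open>q'\<close> both end their edges. There the claim holds because the suffixes at
  edge starts are strictly decreasing from left to right: comparing the starts of the two next
  edges amounts to comparing the starts of the two edges themselves.
\<close>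

section \<open>Lexicographic order\<close>

lemma append_less_append_iff [simp]: "us @ xs < us @ ys \<longleftrightarrow> xs < (ys :: 'a::linorder list)"
  by (induction us) auto

definition begins_above :: "'a::linorder \<Rightarrow> 'a list \<Rightarrow> bool" where
  "begins_above a xs \<longleftrightarrow> xs \<noteq> [] \<and> a < hd xs"

lemma begins_above_Nil [simp]: "\<not> begins_above a []"
  by (simp add: begins_above_def)

lemma begins_above_Cons [simp]: "begins_above a (x # xs) \<longleftrightarrow> a < x"
  by (simp add: begins_above_def)

lemma less_if_begins_above:
  assumes "\<not> begins_above a xs" "begins_above a ys"
  shows "xs < ys"
  using assms by (cases xs; cases ys) auto

lemma begins_above_mono:
  assumes "begins_above a xs" "xs < ys"
  shows "begins_above a ys"
  using assms less_if_begins_above[of a ys xs] by (auto dest: less_asym)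

lemma append_less_append_append:
  fixes u t xs :: "'a::linorder list"
  assumes "u \<le> t" "u \<noteq> []" "sorted_wrt (<) t" "xs < u @ xs"
  shows "u @ xs < t @ u @ xs"
proof -
  have "u = t \<or> (u, t) \<in> lexord {(a, b). a < b}"
    using assms(1) by (auto simp: list_le_def list_less_def)
  then consider (equal) "u = t" | (prefix) c w where "t = u @ c # w"
    | (mismatch) v a b w w' where "a < b" "u = v @ a # w" "t = v @ b # w'"
    unfolding lexord_def by blast
  then show ?thesis
  proof cases
    case equal
    then show ?thesis using assms(4) by simp
  next
    case prefix
    have "hd u < c" using assms(2,3) prefix by (cases u) auto
    moreover have "\<not> begins_above (hd u) xs"
      using begins_above_mono[OF _ assms(4), of "hd u"] assms(2) by (cases u) auto
    ultimately have "xs < c # w @ u @ xs" by (intro less_if_begins_above[of "hd u"]) auto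
    then show ?thesis using prefix by simp
  next
    case mismatch
    then show ?thesis by simp
  qed
qed

section \<open>Suffix arrays\<close>

lemma suffix_array_permutes: "suffix_array T permutes {..<length T}"
  using is_suffix_array_suffix_array[of T] by (simp add: is_suffix_array_def)

lemma suffix_array_less_length_iff [simp]: "suffix_array T i < length T \<longleftrightarrow> i < length T"
  using permutes_in_image[OF suffix_array_permutes, of T i] by simp

lemma inv_suffix_array_less_length_iff [simp]:
  "inv (suffix_array T) q < length T \<longleftrightarrow> q < length T"
  using permutes_in_image[OF permutes_inv[OF suffix_array_permutes], of T q] by simp

lemma drop_suffix_array_less:
  assumes "i < j" "j < length T"
  shows "drop (suffix_array T i) T < drop (suffix_array T j) T"
  using is_suffix_array_suffix_array[of T] assms by (simp add: is_suffix_array_def)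

lemma inv_suffix_array_less_iff:
  assumes "q < length T" "q' < length T"
  shows "inv (suffix_array T) q < inv (suffix_array T) q' \<longleftrightarrow> drop q T < drop q' T"
proof -
  have "strict_mono_on {..<length T} (\<lambda>i. drop (suffix_array T i) T)"
    by (auto intro: strict_mono_onI drop_suffix_array_less)
  from strict_mono_on_less[OF this, of "inv (suffix_array T) q" "inv (suffix_array T) q'"]
  show ?thesis using assms by (simp add: permutes_inverses(1)[OF suffix_array_permutes])
qed

lemma sorted_suffix_array_letters: "sorted (map (\<lambda>i. T ! suffix_array T i) [0..<length T])"
proof -
  have "T ! suffix_array T i \<le> T ! suffix_array T j" if "i < j" "j < length T" for i j
    using drop_suffix_array_less[OF that] that by (auto simp flip: Cons_nth_drop_Suc)
  then show ?thesis by (simp add: sorted_map sorted_wrt_iff_nth_less)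
qed

section \<open>Blocks of a concatenation\<close>

lemma block_start_Suc:
  assumes "m < length ts"
  shows "block_start ts (Suc m) = block_start ts m + length (ts ! m)"
  using assms by (simp add: block_start_def take_Suc_conv_app_nth)

lemma concat_drop_conv_nth:
  assumes "m < length ts"
  shows "concat (drop m ts) = ts ! m @ concat (drop (Suc m) ts)"
  using assms by (simp flip: Cons_nth_drop_Suc)

lemma drop_block_start: "drop (block_start ts m) (concat ts) = concat (drop m ts)"
proof -
  have "concat ts = concat (take m ts) @ concat (drop m ts)"
    by (simp flip: concat_append)
  then show ?thesis by (simp add: block_start_def)
qed

lemma drop_block_start_add:
  assumes "m < length ts" "r \<le> length (ts ! m)"
  shows "drop (block_start ts m + r) (concat ts) = drop r (ts ! m) @ concat (drop (Suc m) ts)"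
proof -
  have "drop (block_start ts m + r) (concat ts) = drop r (concat (drop m ts))"
    by (simp add: add.commute flip: drop_drop drop_block_start)
  then show ?thesis using assms by (simp add: concat_drop_conv_nth)
qed

lemma block_start_add_less:
  assumes "m < length ts" "r < length (ts ! m)"
  shows "block_start ts m + r < length (concat ts)"
  using drop_block_start_add[of m ts r] assms
  by (metis append_is_Nil_conv drop_eq_Nil less_imp_le not_le)

lemma nth_block_start_add:
  assumes "m < length ts" "r < length (ts ! m)"
  shows "concat ts ! (block_start ts m + r) = ts ! m ! r"
  using drop_block_start_add[of m ts r] block_start_add_less[of m ts r] assms
  by (simp flip: Cons_nth_drop_Suc)

lemma block_start_addE:
  assumes "q < length (concat ts)"
  obtains m r where "m < length ts" "r < length (ts ! m)" "q = block_start ts m + r"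
proof -
  obtain m where "m < length ts" "block_start ts m \<le> q" "q < block_start ts (Suc m)"
    using block_exists[OF assms] by blast
  then show thesis using that[of m "q - block_start ts m"] by (simp add: block_start_Suc)
qed

definition cyclic_next :: "'a list list \<Rightarrow> nat \<Rightarrow> nat" where
  "cyclic_next ts q =
     (let m = block_of ts q
      in if q + 1 < block_start ts (Suc m) then q + 1 else block_start ts m)"

lemma cyclic_next_block_start_add:
  assumes "m < length ts" "r < length (ts ! m)"
  shows "cyclic_next ts (block_start ts m + r) =
    block_start ts m + (if Suc r < length (ts ! m) then Suc r else 0)"
  using assms block_of_eq[of m ts "block_start ts m + r"]
  by (simp add: cyclic_next_def block_start_Suc)

lemma cyclic_next_less:
  assumes "q < length (concat ts)"
  shows "cyclic_next ts q < length (concat ts)"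
proof -
  obtain m r where m: "m < length ts" and r: "r < length (ts ! m)"
    and q: "q = block_start ts m + r"
    using block_start_addE[OF assms] .
  have "(if Suc r < length (ts ! m) then Suc r else 0) < length (ts ! m)"
    using r by auto
  from block_start_add_less[OF m this] show ?thesis
    by (simp add: q cyclic_next_block_start_add[OF m r])
qed

section \<open>Descending concatenations of ascending tuples\<close>

locale descending_tuples =
  fixes ts :: "'a::linorder list list"
  assumes descending: "sorted_wrt (\<ge>) ts"
    and ascending: "t \<in> set ts \<Longrightarrow> sorted_wrt (<) t"
    and nonempty: "t \<in> set ts \<Longrightarrow> t \<noteq> []"
begin

lemma concat_drop_Suc_less:
  assumes "m < length ts"
  shows "concat (drop (Suc m) ts) < concat (drop m ts)"
  using assms
proof (induction m rule: strict_inc_induct)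
  case (base m)
  then have "ts ! m \<noteq> []" by (simp add: nonempty)
  then show ?case using base by (cases "ts ! m") (simp_all add: concat_drop_conv_nth)
next
  case (step m)
  have "ts ! Suc m \<le> ts ! m"
    using sorted_wrt_nth_less[OF descending] step.hyps by simp
  moreover have "concat (drop (Suc (Suc m)) ts) < ts ! Suc m @ concat (drop (Suc (Suc m)) ts)"
    using step by (simp add: concat_drop_conv_nth)
  ultimately have "ts ! Suc m @ concat (drop (Suc (Suc m)) ts)
      < ts ! m @ ts ! Suc m @ concat (drop (Suc (Suc m)) ts)"
    using step.hyps by (intro append_less_append_append) (simp_all add: ascending nonempty)
  then show ?case using step.hyps by (simp add: concat_drop_conv_nth)
qed

lemma concat_drop_less:
  assumes "m < m'" "m' \<le> length ts"
  shows "concat (drop m' ts) < concat (drop m ts)"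
  using assms(1)
proof (induction m rule: strict_inc_induct)
  case (base m)
  then show ?case using assms(2) concat_drop_Suc_less[of m] by simp
next
  case (step m)
  then show ?case using assms(2) concat_drop_Suc_less[of m] by (auto intro: less_trans)
qed

lemma concat_drop_less_iff:
  assumes "m \<le> length ts" "m' \<le> length ts"
  shows "concat (drop m ts) < concat (drop m' ts) \<longleftrightarrow> m' < m"
  using concat_drop_less[of m m'] concat_drop_less[of m' m] assms
  by (metis less_asym less_irrefl linorder_neqE_nat)

lemma cyclic_next_cases:
  assumes q: "q < length (concat ts)"
  obtains
    (inner) "drop (cyclic_next ts q) (concat ts) = drop (Suc q) (concat ts)"
      "begins_above (concat ts ! q) (drop (Suc q) (concat ts))"
  | (block_end) m where "m < length ts"
      "drop (Suc q) (concat ts) = concat (drop (Suc m) ts)"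
      "drop (cyclic_next ts q) (concat ts) = concat (drop m ts)"
      "\<not> begins_above (concat ts ! q) (concat (drop m ts))"
proof -
  obtain m r where m: "m < length ts" and r: "r < length (ts ! m)"
    and q_eq: "q = block_start ts m + r"
    using block_start_addE[OF q] .
  have letter: "concat ts ! q = ts ! m ! r"
    using nth_block_start_add[OF m r] q_eq by simp
  have tail: "drop (Suc q) (concat ts) = drop (Suc r) (ts ! m) @ concat (drop (Suc m) ts)"
    using drop_block_start_add[OF m, of "Suc r"] r q_eq by simp
  have tuple: "sorted_wrt (<) (ts ! m)" using ascending m by simp
  show thesis
  proof (cases "Suc r < length (ts ! m)")
    case True
    then have "cyclic_next ts q = Suc q"
      using cyclic_next_block_start_add[OF m r] q_eq by simp
    moreover have "begins_above (ts ! m ! r) (drop (Suc q) (concat ts))"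
      using tail sorted_wrt_nth_less[OF tuple _ True, of r] True
      by (simp flip: Cons_nth_drop_Suc)
    ultimately show thesis using inner letter by simp
  next
    case False
    have "hd (ts ! m) \<le> ts ! m ! r"
      using sorted_nth_mono[OF strict_sorted_imp_sorted[OF tuple], of 0 r] r
      by (simp add: hd_conv_nth flip: length_greater_0_conv)
    then have "\<not> begins_above (ts ! m ! r) (concat (drop m ts))"
      using m nonempty by (simp add: begins_above_def concat_drop_conv_nth)
    moreover have "drop (cyclic_next ts q) (concat ts) = concat (drop m ts)"
      using cyclic_next_block_start_add[OF m r] q_eq False by (simp add: drop_block_start)
    ultimately show thesis using block_end m tail letter False by simp
  qed
qed

lemma drop_cyclic_next_less:
  assumes q: "q < length (concat ts)" and q': "q' < length (concat ts)"
    and letter: "concat ts ! q = concat ts ! q'"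
    and less: "drop q (concat ts) < drop q' (concat ts)"
  shows "drop (cyclic_next ts q) (concat ts) < drop (cyclic_next ts q') (concat ts)"
proof -
  have tails: "drop (Suc q) (concat ts) < drop (Suc q') (concat ts)"
    using less letter q q' by (simp flip: Cons_nth_drop_Suc)
  from q show ?thesis
  proof (cases rule: cyclic_next_cases)
    case q_inner: inner
    have above: "begins_above (concat ts ! q') (drop (Suc q') (concat ts))"
      using begins_above_mono[OF q_inner(2) tails] letter by simp
    from q' show ?thesis
    proof (cases rule: cyclic_next_cases)
      case inner
      then show ?thesis using q_inner tails by simp
    next
      case (block_end m')
      then have "begins_above (concat ts ! q') (concat (drop m' ts))"
        using begins_above_mono above concat_drop_Suc_less by metis
      with block_end show ?thesis by blast
    qed
  next
    case q_end: (block_end m)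
    from q' show ?thesis
    proof (cases rule: cyclic_next_cases)
      case inner
      then show ?thesis
        using q_end letter less_if_begins_above[of "concat ts ! q"] by simp
    next
      case (block_end m')
      then show ?thesis
        using q_end tails by (simp add: concat_drop_less_iff)
    qed
  qed
qed

end

section \<open>Runs of a list sorted by a key\<close>

lemma filter_append_filter_key:
  fixes f :: "'a \<Rightarrow> 'b::linorder"
  assumes "sorted (map f xs)" "\<And>k'. k' \<in> K \<Longrightarrow> k < k'"
  shows "filter (\<lambda>x. f x = k) xs @ filter (\<lambda>x. f x \<in> K) xs = filter (\<lambda>x. f x \<in> insert k K) xs"
  using assms(1)
proof (induction xs)
  case (Cons x xs)
  have "filter (\<lambda>y. f y = k) (x # xs) = []" if "f x \<in> K"
    using assms(2)[OF that] Cons.prems by (fastforce simp: filter_empty_conv)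
  then show ?case using Cons by (auto split: if_splits)
qed simp

lemma concat_filter_key:
  fixes f :: "'a \<Rightarrow> 'b::linorder"
  assumes "sorted (map f xs)" "sorted_wrt (<) ks"
  shows "concat (map (\<lambda>k. filter (\<lambda>x. f x = k) xs) ks) = filter (\<lambda>x. f x \<in> set ks) xs"
  using assms(2)
proof (induction ks)
  case (Cons k ks)
  then show ?case
    using filter_append_filter_key[OF assms(1), of "set ks" k] by simp
qed simp

lemma sorted_key_runs:
  fixes f :: "'a \<Rightarrow> 'b::linorder"
  assumes "sorted (map f xs)" and "sorted_wrt (\<lambda>x y. f x = f y \<longrightarrow> R x y) xs"
  obtains runs where "concat runs = xs" "length runs = card (f ` set xs)"
    "\<And>r. r \<in> set runs \<Longrightarrow> sorted_wrt R r"
proof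
  let ?keys = "sorted_list_of_set (f ` set xs)"
  let ?runs = "map (\<lambda>k. filter (\<lambda>x. f x = k) xs) ?keys"
  show "concat ?runs = xs"
    using assms(1) by (subst concat_filter_key) simp_all
  show "length ?runs = card (f ` set xs)" by simp
  show "sorted_wrt R r" if r_run: "r \<in> set ?runs" for r
  proof -
    from r_run obtain k where r: "r = filter (\<lambda>x. f x = k) xs" by auto
    then have "sorted_wrt (\<lambda>x y. f x = f y \<longrightarrow> R x y) r"
      using sorted_wrt_filter[OF assms(2)] by simp
    then show ?thesis by (rule sorted_wrt_mono_rel[rotated]) (simp add: r)
  qed
qed

section \<open>Hypergraphs\<close>

lemma Psi_eq_cyclic_next:
  "Psi E i =
    inv (suffix_array (edge_text E)) (cyclic_next (edge_tuples E) (suffix_array (edge_text E) i))"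
  by (simp add: Psi_def cyclic_next_def Let_def)

lemma hypergraph_finite: "hypergraph V E \<Longrightarrow> finite V"
  by (auto simp: hypergraph_def)

lemma hypergraph_finite_edge: "hypergraph V E \<Longrightarrow> e \<in># E \<Longrightarrow> finite e"
  unfolding hypergraph_def by (meson finite_atLeastAtMost finite_subset)

lemma set_edge_tuples: "set (edge_tuples E) = sorted_list_of_set ` set_mset E"
  by (simp add: edge_tuples_def)

lemma set_edge_text_subset:
  assumes "hypergraph V E"
  shows "set (edge_text E) \<subseteq> V"
  using assms hypergraph_finite_edge[OF assms]
  by (auto simp: edge_text_def set_edge_tuples hypergraph_def)

lemma descending_tuples_edge_tuples:
  assumes "hypergraph V E"
  shows "descending_tuples (edge_tuples E)"
proof
  show "sorted_wrt (\<ge>) (edge_tuples E)"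
    by (simp add: edge_tuples_def sorted_wrt_rev)
  show "sorted_wrt (<) t" if "t \<in> set (edge_tuples E)" for t
    using that by (auto simp: set_edge_tuples)
  show "t \<noteq> []" if "t \<in> set (edge_tuples E)" for t
    using that assms hypergraph_finite_edge[OF assms] by (auto simp: set_edge_tuples hypergraph_def)
qed

lemma Psi_less_Psi:
  fixes E :: "nat set multiset"
  defines "T \<equiv> edge_text E"
  assumes "hypergraph V E" "i < j" "j < length T" "T ! suffix_array T i = T ! suffix_array T j"
  shows "Psi E i < Psi E j"
proof -
  let ?next = "cyclic_next (edge_tuples E)"
  interpret descending_tuples "edge_tuples E"
    using descending_tuples_edge_tuples[OF assms(2)] .
  have T: "concat (edge_tuples E) = T" by (simp add: T_def edge_text_def)
  have in_T: "suffix_array T i < length T" "suffix_array T j < length T"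
    using assms(3,4) by simp_all
  have "drop (suffix_array T i) T < drop (suffix_array T j) T"
    using assms(3,4) by (rule drop_suffix_array_less)
  then have "drop (?next (suffix_array T i)) T < drop (?next (suffix_array T j)) T"
    using drop_cyclic_next_less in_T assms(5) T by metis
  moreover have "?next (suffix_array T i) < length T" "?next (suffix_array T j) < length T"
    using cyclic_next_less in_T T by metis+
  ultimately show ?thesis
    by (simp add: Psi_eq_cyclic_next inv_suffix_array_less_iff flip: T_def)
qed

theorem theorem2:
  fixes V :: "nat set" and E :: "nat set multiset"
  assumes "hypergraph V E"
  shows "\<exists>runs :: nat list list.
           concat runs = map (Psi E) [0..<total_size E] \<and>
           length runs \<le> card V \<and>
           (\<forall>r\<in>set runs. sorted_wrt (<) r)"
proof -
  let ?T = "edge_text E"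
  let ?letter = "\<lambda>i. ?T ! suffix_array ?T i"
  have "sorted_wrt (\<lambda>i j. ?letter i = ?letter j \<longrightarrow> Psi E i < Psi E j) [0..<length ?T]"
    by (simp add: sorted_wrt_iff_nth_less Psi_less_Psi[OF assms])
  then obtain runs where runs: "concat runs = [0..<length ?T]"
    "length runs = card (?letter ` set [0..<length ?T])"
    "\<And>r. r \<in> set runs \<Longrightarrow> sorted_wrt (\<lambda>i j. Psi E i < Psi E j) r"
    by (rule sorted_key_runs[OF sorted_suffix_array_letters]) blast
  have "?letter ` set [0..<length ?T] \<subseteq> V"
    using set_edge_text_subset[OF assms] by (auto simp: subset_iff)
  then have "length runs \<le> card V"
    using runs(2) card_mono[OF hypergraph_finite[OF assms]] by simp
  moreover have "concat (map (map (Psi E)) runs) = map (Psi E) [0..<total_size E]"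
    using runs(1) length_edge_text[OF assms] by (simp flip: map_concat)
  ultimately show ?thesis
    using runs(3) by (intro exI[of _ "map (map (Psi E)) runs"]) (auto simp: sorted_wrt_map)
qed

end
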